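(* Let $\Delta t>0$, let $S_\tau$ be the time-$\tau$ solution map of $\dot u=F(u)$, and let $R_\ast^+>R_\ast$ and $\mathcal B_\ast^+:=\{z:\|z\|_V<R_\ast^+\}$. Assume $S_\tau(z)\in\mathcal B_\ast^+$ for all $z\in\mathcal B_\ast$ and $0\le\tau\le\Delta t$, and that $F\in C^{1,1}(\mathcal B_\ast^+;H)$ with $F$ and $DF$ uniformly bounded on $\overline{\mathcal B_\ast^+}$ and $DF$ Lipschitz on $\overline{\mathcal B_\ast^+}$. Let $C_{\rm flow}<\infty$ be a constant such that $$\sup_{z\in\mathcal B_\ast}\|S_{\Delta t}(z)-z-\Delta t\,F(z)\|_H\le C_{\rm flow}\Delta t^2,\qquad \sup_{z\in\mathcal B_\ast}\|DS_{\Delta t}(z)-I-\Delta t\,DF(z)\|_{\mathcal L(H,H)}\le C_{\rm flow}\Delta t^2$$ (such a constant exists under these hypotheses). Suppose $\widehat S_{\Delta t}^{(M)}\in C^1(\mathcal B_\ast;H)$, define $\widehat F_M(z):=(\widehat S_{\Delta t}^{(M)}(z)-z)/\Delta t$, and let $F_M$ be the cutoff extension of $\widehat F_M$ (see context), so that $F_M\equiv\widehat F_M$ on $\mathcal B_\ast$. Put $$\varepsilon_M^S:=\sup_{z\in\mathcal B_\ast}\|\widehat S_{\Delta t}^{(M)}(z)-S_{\Delta t}(z)\|_H,\qquad \eta_M^S:=\sup_{z\in\mathcal B_\ast}\|D\widehat S_{\Delta t}^{(M)}(z)-DS_{\Delta t}(z)\|_{\mathcal L(H,H)},$$ and, with $r_M:=F_M-F$,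 $\delta_M:=\sup_{z\in\mathcal B_\ast}\|r_M(z)\|_H$, $\ell_M:=\sup_{z\ne z'\in\mathcal B_\ast}\frac{\|r_M(z')-r_M(z)\|_H}{\|z'-z\|_H}$. Then $$\delta_M\le\frac{\varepsilon_M^S}{\Delta t}+C_{\rm flow}\Delta t,\qquad \ell_M\le\frac{\eta_M^S}{\Delta t}+C_{\rm flow}\Delta t .$$ Consequently, under the structural and cutoff assumptions of the context, if $$\mu>2\Bigl(C_{\rm sq}+\frac{\eta_M^S}{\Delta t}+C_{\rm flow}\Delta t\Bigr),\qquad \mu c_0^2h^2<\nu,$$ then $\mu>2(C_{\rm sq}+\ell_M)$ and, with $\gamma_M:=\mu-2(C_{\rm sq}+\ell_M)$ and $\nu_{\rm eff}:=\nu-\frac{\mu c_0^2h^2}2$, the solutions $u,v$ of $\dot u=F(u)$ and $\dot v=F_M(v)-\mu(I_hv-I_hu)$ with arbitrary initial data satisfy, for every $t\ge T_\ast$, $$\|v(t)-u(t)\|_H^2\le e^{-\gamma_M(t-T_\ast)}\|v(T_\ast)-u(T_\ast)\|_H^2+\frac{\delta_M^2}{\lambda_1\nu_{\rm eff}\gamma_M}\bigl(1-e^{-\gamma_M(t-T_\ast)}\bigr),$$ with $\delta_M,\ell_M$ controlled by the bounds above.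
   Context: $H=\mathbb R^d$ with Euclidean inner product $\langle z,z'\rangle_H=z^\top z'$ and norm $\|\cdot\|_H$; $\mathcal L(H,H)$ carries the operator norm. $\nu>0$, $f\in\mathbb R^d$, $A\in\mathbb R^{d\times d}$, $N:\mathbb R^d\to\mathbb R^d$, $F(z):=f-\nu Az-N(z)$. Structural assumptions. - $A$ is symmetric positive definite; $\lambda_1>0$ is its smallest eigenvalue, $\|z\|_V:=\sqrt{z^\top Az}$. - There are $\alpha>0$, $\beta\ge0$ with $\nu z^\top Az+\langle N(z),z\rangle_H\ge \alpha\|z\|_H^2-\beta$ for all $z$. - $N$ is locally Lipschitz; there is $C_{\mathrm E}\ge0$ with $\langle N(z),z\rangle_H\ge -C_{\mathrm E}\|z\|_H^2$ for all $z$; for every $R>0$ there is a constant $C_R\ge0$ (local monotonicity constant) with $-\langle N(z')-N(z),z'-z\rangle_H\le C_R\|z'-z\|_H^2$ whenever $\|z\|_H,\|z'\|_H\le R$. - For each $h\in[0,1]$, $I_h:\mathbb R^d\to\mathbb R^d$ is linear and $\|z-I_hz\|_H\le c_0h\|z\|_V$ for all $z$, with $c_0>0$ independent of $z,h$; $C_I>0$ is a constant, independent of $h$, with $\|I_hz\|_H\le C_I\|z\|_H$. Here $h\in[0,1]$ is fixed. Under these assumptions $\dot u=F(u)$, $u(0)=z$ has a unique global solution $u(t;z)$, and $S_\tau(z):=u(\tau;z)$. Cutoff assumptions. $R_{\rm ext}^+>R_{\rm ext}>0$; $\psi\in C^\infty([0,\infty);[0,1])$ with $\psi(r)=1$ for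 $r\le R_{\rm ext}^2$, $\psi(r)=0$ for $r\ge(R_{\rm ext}^+)^2$; $\chi(z):=\psi(\|z\|_V^2)$; $B\in\mathbb R^{d\times d}$ symmetric positive definite with $\lambda_{\min}(B)-\mu C_I>0$, where $\mu>0$. $\widehat S_{\Delta t}^{(M)}$ (hence $\widehat F_M$) is defined and locally Lipschitz on an open neighborhood of $\{\|z\|_V\le R_{\rm ext}^+\}$, and $F_M(z):=\chi(z)\widehat F_M(z)+(1-\chi(z))(f-Bz)$, the first term being $0$ wherever $\chi=0$. Post-absorption ball. $\mathcal B_\ast:=\{z:\|z\|_V\le R_\ast\}$, where $0<R_\ast\le R_{\rm ext}$ and $T_\ast\ge0$ are such that $u(t),v(t)\in\mathcal B_\ast$ for all $t\ge T_\ast$. $C_{\rm sq}:=C_{R_\ast/\sqrt{\lambda_1}}$. For a function in $C^1(\mathcal B_\ast;H)$, derivatives on $\mathcal B_\ast$ are those on the interior extended continuously. *)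

theory Defs
  imports "HOL-Analysis.Analysis"
begin

definition sym_pos_def :: "real^'n^'n \<Rightarrow> bool" where
  "sym_pos_def A \<longleftrightarrow> transpose A = A \<and> (\<forall>z. z \<noteq> 0 \<longrightarrow> z \<bullet> (A *v z) > 0)"

definition matrix_eigenvalue :: "real^'n^'n \<Rightarrow> real \<Rightarrow> bool" where
  "matrix_eigenvalue A l \<longleftrightarrow> (\<exists>x. x \<noteq> 0 \<and> A *v x = l *\<^sub>R x)"

text \<open>Only meaningful if \<^term>\<open>A\<close> has a least real eigenvalue, e.g. if \<^term>\<open>A\<close> is symmetric.\<close>
definition smallest_eigenvalue :: "real^'n^'n \<Rightarrow> real" where
  "smallest_eigenvalue A = (LEAST l. matrix_eigenvalue A l)"

definition energy_norm :: "real^'n^'n \<Rightarrow> real^'n \<Rightarrow> real" where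
  "energy_norm A z = sqrt (z \<bullet> (A *v z))"

text \<open>\<open>C\<^sup>\<infinity>\<close> on a set of reals, with one-sided derivatives where the set has an
  end point: \<open>D k\<close> is the \<open>k\<close>-th derivative.\<close>
definition smooth_real_on :: "real set \<Rightarrow> (real \<Rightarrow> real) \<Rightarrow> bool" where
  "smooth_real_on T g \<longleftrightarrow>
     (\<exists>D :: nat \<Rightarrow> real \<Rightarrow> real. (\<forall>r\<in>T. D 0 r = g r) \<and>
        (\<forall>k. \<forall>r\<in>T. (D k has_real_derivative D (Suc k) r) (at r within T)))"

text \<open>\<open>C\<^sup>1\<close> on a set \<^term>\<open>K\<close> that is the closure of its interior: the derivative
  on the interior extends continuously to \<^term>\<open>K\<close>. The extension is unique on such a \<^term>\<open>K\<close>,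
  and the norm on its value type is the operator norm.\<close>
definition has_C1_derivative_on ::
  "('a::real_normed_vector \<Rightarrow> 'b::real_normed_vector) \<Rightarrow> ('a \<Rightarrow> 'a \<Rightarrow>\<^sub>L 'b) \<Rightarrow> 'a set \<Rightarrow> bool" where
  "has_C1_derivative_on g D K \<longleftrightarrow>
     continuous_on K g \<and> continuous_on K D \<and>
     (\<forall>x\<in>interior K. (g has_derivative blinfun_apply (D x)) (at x))"

definition C1_on :: "'a::real_normed_vector set \<Rightarrow> ('a \<Rightarrow> 'b::real_normed_vector) \<Rightarrow> bool" where
  "C1_on K g \<longleftrightarrow> (\<exists>D. has_C1_derivative_on g D K)"

text \<open>Only meaningful if \<^term>\<open>C1_on K g\<close>, and only at points of \<^term>\<open>K\<close>.\<close>
definition C1_derivative ::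
  "'a::real_normed_vector set \<Rightarrow> ('a \<Rightarrow> 'b::real_normed_vector) \<Rightarrow> 'a \<Rightarrow> 'a \<Rightarrow>\<^sub>L 'b" where
  "C1_derivative K g = (SOME D. has_C1_derivative_on g D K)"

definition ode_solution :: "(real \<Rightarrow> 'a \<Rightarrow> 'a) \<Rightarrow> (real \<Rightarrow> 'a::real_normed_vector) \<Rightarrow> bool" where
  "ode_solution G x \<longleftrightarrow> (\<forall>t\<ge>0. (x has_vector_derivative G t (x t)) (at t within {0..}))"

text \<open>The field \<^term>\<open>G\<close> may be meaningless where the cutoff factor vanishes; as functions
  are total, the first summand is then \<open>0\<close>.\<close>
definition cutoff_extension ::
  "(real \<Rightarrow> real) \<Rightarrow> real^'n^'n \<Rightarrow> real^'n^'n \<Rightarrow> real^'n \<Rightarrow> (real^'n \<Rightarrow> real^'n) \<Rightarrow> real^'n \<Rightarrow> real^'n" where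
  "cutoff_extension \<psi> A B f G z =
     (let c = \<psi> ((energy_norm A z)\<^sup>2) in c *\<^sub>R G z + (1 - c) *\<^sub>R (f - B *v z))"

definition sup_norm_on :: "'a set \<Rightarrow> ('a \<Rightarrow> 'b::real_normed_vector) \<Rightarrow> real" where
  "sup_norm_on K g = (SUP z\<in>K. norm (g z))"

definition lipschitz_const_on ::
  "'a::real_normed_vector set \<Rightarrow> ('a \<Rightarrow> 'b::real_normed_vector) \<Rightarrow> real" where
  "lipschitz_const_on K g =
     (SUP (z, z')\<in>{(z, z'). z \<in> K \<and> z' \<in> K \<and> z \<noteq> z'}. norm (g z' - g z) / norm (z' - z))"

definition flow_consistency_bound ::
  "'a::real_normed_vector set \<Rightarrow> ('a \<Rightarrow> 'a) \<Rightarrow> ('a \<Rightarrow> 'a \<Rightarrow>\<^sub>L 'a) \<Rightarrow> ('a \<Rightarrow> 'a) \<Rightarrow> real \<Rightarrow> real \<Rightarrow> bool" where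
  "flow_consistency_bound K F DF \<Phi> dt C \<longleftrightarrow>
     (\<forall>z\<in>K. norm (\<Phi> z - z - dt *\<^sub>R F z) \<le> C * dt\<^sup>2) \<and>
     (\<forall>z\<in>K. norm (C1_derivative K \<Phi> z - id_blinfun - dt *\<^sub>R DF z) \<le> C * dt\<^sup>2)"

end

theory Submission
  imports Defs
begin

text \<open>On the energy ball the one-step residual splits as
  \<open>\<Delta>t r\<^sub>M = (Shat - S) + (S - id - \<Delta>t F)\<close>, and its derivative splits in the same way; the
  Lipschitz constant comes from the mean value inequality on the open ball, passed to the closure.
  The map \<open>S\<close> is \<open>C\<^sup>1\<close> because trajectories starting in the ball stay in the larger ball, where
  the derivative of \<open>F\<close> is bounded and Lipschitz: the variational equation has a solution, and
  a Gronwall argument shows that it is the derivative and depends continuously on the initial point.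
  As \<open>\<Delta>t\<close> is fixed, a consistency constant then exists by compactness.
  The error estimate follows from the energy identity for \<open>v - u\<close>, Young's inequality and
  Gronwall's lemma.\<close>

section \<open>Gronwall inequalities\<close>

text \<open>The integrating factor \<open>exp (g * (s - a))\<close> makes the weighted deviation of
  \<open>y\<close> from the equilibrium \<open>c / g\<close> nonincreasing. The sign of
  \<open>g\<close> is free: negative values give growth bounds along trajectories, positive ones the
  decay in the error estimate.\<close>

lemma gronwall_affine:
  fixes y y' :: "real \<Rightarrow> real"
  assumes deriv: "\<And>t. t \<in> {a..b} \<Longrightarrow> (y has_vector_derivative y' t) (at t within {a..b})"
    and le: "\<And>t. t \<in> {a..b} \<Longrightarrow> y' t \<le> - g * y t + c"
    and g: "g \<noteq> 0" and t: "t \<in> {a..b}"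
  shows "y t \<le> exp (- g * (t - a)) * y a + c / g * (1 - exp (- g * (t - a)))"
proof -
  define p where "p s = exp (g * (s - a)) * (y s - c / g)" for s
  have dp: "(p has_real_derivative exp (g * (s - a)) * (g * y s - c + y' s)) (at s within {a..b})"
    if "s \<in> {a..b}" for s
    using g unfolding p_def
    by (auto intro!: derivative_eq_intros deriv[OF that, folded has_real_derivative_iff_has_vector_derivative]
        simp: field_simps)
  have "p t \<le> p a"
  proof (rule DERIV_nonpos_imp_decreasing_open[where f = p])
    show "a \<le> t" using t by simp
    fix s assume s: "a < s" "s < t"
    then have "(p has_real_derivative exp (g * (s - a)) * (g * y s - c + y' s)) (at s)"
      using dp[of s] t at_within_interior[of s "{a..b}"] by simp
    moreover have "exp (g * (s - a)) * (g * y s - c + y' s) \<le> 0"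
      using le[of s] s t by (intro mult_nonneg_nonpos) auto
    ultimately show "\<exists>y. (p has_real_derivative y) (at s) \<and> y \<le> 0" by blast
  next
    have "continuous_on {a..b} p" using dp by (rule DERIV_continuous_on)
    then show "continuous_on {a..t} p" by (rule continuous_on_subset) (use t in auto)
  qed
  then have "exp (- g * (t - a)) * p t \<le> exp (- g * (t - a)) * p a"
    by (intro mult_left_mono) auto
  moreover have "exp (- g * (t - a)) * p t = y t - c / g"
    by (simp add: p_def mult.assoc[symmetric] exp_add[symmetric])
  ultimately show ?thesis by (simp add: p_def algebra_simps)
qed

text \<open>The square of the norm is estimated, since the norm itself need not be differentiable at
  zeros of \<open>E\<close>; the rate becomes \<open>K + 1\<close> instead of \<open>K\<close>. All
  comparisons of trajectories and of their linearisations rest on this bound.\<close>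

lemma gronwall_norm:
  fixes E E' :: "real \<Rightarrow> 'a::real_inner"
  assumes deriv: "\<And>t. t \<in> {0..T} \<Longrightarrow> (E has_vector_derivative E' t) (at t within {0..T})"
    and le: "\<And>t. t \<in> {0..T} \<Longrightarrow> norm (E' t) \<le> K * norm (E t) + c"
    and nonneg: "K \<ge> 0" "c \<ge> 0" and t: "t \<in> {0..T}"
  shows "norm (E t) \<le> exp ((K + 1) * T) * (norm (E 0) + c)"
proof -
  \<comment> \<open>The part \<open>2 * K\<close> comes from the growth bound, the summand 1 from
    Young's inequality for the cross term \<open>2 * c * norm (E s)\<close>.\<close>
  define g where "g = - (2 * K + 1)"
  have g: "g \<noteq> 0" "g < 0" using nonneg by (auto simp: g_def)
  have "E t \<bullet> E t \<le> exp (- g * (t - 0)) * (E 0 \<bullet> E 0) + c\<^sup>2 / g * (1 - exp (- g * (t - 0)))"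
  proof (rule gronwall_affine[where y = "\<lambda>t. E t \<bullet> E t" and y' = "\<lambda>t. 2 * (E' t \<bullet> E t)" and b = T])
    fix s assume s: "s \<in> {0..T}"
    show "((\<lambda>t. E t \<bullet> E t) has_vector_derivative 2 * (E' s \<bullet> E s)) (at s within {0..T})"
      using bounded_bilinear.has_vector_derivative[OF bounded_bilinear_inner deriv[OF s] deriv[OF s]]
      by (simp add: inner_commute)
    have "E' s \<bullet> E s \<le> norm (E' s) * norm (E s)" by (rule norm_cauchy_schwarz)
    also have "\<dots> \<le> (K * norm (E s) + c) * norm (E s)"
      using le[OF s] by (intro mult_right_mono) auto
    finally have "2 * (E' s \<bullet> E s) \<le> 2 * K * (norm (E s))\<^sup>2 + 2 * c * norm (E s)"
      by (simp add: algebra_simps power2_eq_square)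
    also have "2 * c * norm (E s) \<le> c\<^sup>2 + (norm (E s))\<^sup>2"
      by (rule sum_squares_bound)
    finally show "2 * (E' s \<bullet> E s) \<le> - g * (E s \<bullet> E s) + c\<^sup>2"
      by (simp add: g_def power2_norm_eq_inner algebra_simps)
  qed (use g t in auto)
  also have "c\<^sup>2 / g * (1 - exp (- g * (t - 0))) \<le> c\<^sup>2 * exp (- g * (t - 0))"
  proof -
    have "(e - 1) / (2 * K + 1) \<le> e" if "e \<ge> 0" for e
      using mult_nonneg_nonneg[OF that nonneg(1)] that nonneg by (simp add: divide_le_eq algebra_simps)
    then have "(exp (- g * t) - 1) / (2 * K + 1) \<le> exp (- g * t)" by simp
    then have "c\<^sup>2 * ((exp (- g * t) - 1) / (2 * K + 1)) \<le> c\<^sup>2 * exp (- g * t)"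
      by (intro mult_left_mono) auto
    moreover have "c\<^sup>2 / g * (1 - exp (- g * t)) = c\<^sup>2 * ((exp (- g * t) - 1) / (2 * K + 1))"
      using nonneg by (simp add: g_def divide_simps) (simp add: algebra_simps)
    ultimately show ?thesis by simp
  qed
  finally have "(norm (E t))\<^sup>2 \<le> exp (- g * t) * ((norm (E 0))\<^sup>2 + c\<^sup>2)"
    by (simp add: power2_norm_eq_inner algebra_simps)
  \<comment> \<open>Rounding the rate up to \<open>2 * (K + 1)\<close> and the time up to
    \<open>T\<close> leaves a perfect square, whose root can be taken.\<close>
  also have "\<dots> \<le> exp (2 * ((K + 1) * T)) * (norm (E 0) + c)\<^sup>2"
  proof (rule mult_mono)
    have "(2 * K + 1) * t \<le> (2 * (K + 1)) * T"
      using t nonneg by (intro mult_mono) auto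
    then show "exp (- g * t) \<le> exp (2 * ((K + 1) * T))" by (simp add: g_def algebra_simps)
    show "(norm (E 0))\<^sup>2 + c\<^sup>2 \<le> (norm (E 0) + c)\<^sup>2"
      using nonneg by (simp add: power2_sum)
  qed auto
  also have "\<dots> = (exp ((K + 1) * T) * (norm (E 0) + c))\<^sup>2"
    by (simp only: power_mult_distrib exp_double)
  finally show ?thesis
    by (rule power2_le_imp_le) (use nonneg in auto)
qed

section \<open>Linear equations with continuous operator coefficients\<close>

text \<open>The solution is the Picard series \<open>\<Sum>n. Y n\<close>, whose terms satisfy
  \<open>norm (Y n t) \<le> (K t) ^ n / n!\<close>.\<close>

lemma linear_ode_fundamental_solution:
  fixes A :: "real \<Rightarrow> 'a::banach \<Rightarrow>\<^sub>L 'a"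
  assumes cont: "continuous_on {0..T} A" and T: "T \<ge> 0"
  obtains Y where "Y 0 = id_blinfun"
    "\<And>t. t \<in> {0..T} \<Longrightarrow> (Y has_vector_derivative A t o\<^sub>L Y t) (at t within {0..T})"
proof -
  have "bounded (A ` {0..T})"
    by (intro compact_imp_bounded compact_continuous_image cont) auto
  then obtain K where K: "K > 0" "\<And>t. t \<in> {0..T} \<Longrightarrow> norm (A t) \<le> K"
    by (auto simp: bounded_pos)
  \<comment> \<open>\<open>Y n\<close> is the \<open>n\<close>-th increment of the Picard iteration,
    an \<open>n\<close>-fold iterated integral, and not the \<open>n\<close>-th iterate.\<close>
  define Y where "Y = rec_nat (\<lambda>_. id_blinfun) (\<lambda>_ X t. integral {0..t} (\<lambda>s. A s o\<^sub>L X s))"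
  have Y0: "Y 0 = (\<lambda>_. id_blinfun)"
    and YSuc: "Y (Suc n) = (\<lambda>t. integral {0..t} (\<lambda>s. A s o\<^sub>L Y n s))" for n
    by (simp_all add: Y_def)
  have deriv_if: "(Y (Suc n) has_vector_derivative A t o\<^sub>L Y n t) (at t within {0..T})"
    if "continuous_on {0..T} (Y n)" "t \<in> {0..T}" for n t
    unfolding YSuc
    by (rule integral_has_vector_derivative)
      (use that in \<open>auto intro!: bounded_bilinear.continuous_on[OF bounded_bilinear_blinfun_compose] cont\<close>)
  have Y_cont: "continuous_on {0..T} (Y n)" for n
  proof (induction n)
    case (Suc n)
    show ?case
      by (rule continuous_on_vector_derivative[OF deriv_if[OF Suc]])
  qed (simp add: Y0)
  note Y_deriv = deriv_if[OF Y_cont]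
  have Y_le: "norm (Y n t) \<le> (K * t) ^ n / fact n" if "t \<in> {0..T}" for n t
    using that
  proof (induction n arbitrary: t)
    case 0
    then show ?case by (simp add: Y0 norm_blinfun_id_le)
  next
    case (Suc n)
    show ?case
    proof (cases "t = 0")
      case False
      then have t: "0 < t" "t \<le> T" using Suc.prems by auto
      \<comment> \<open>The scalar majorant on the right has derivative
        \<open>K * ((K * s) ^ n / fact n)\<close>, which by the induction hypothesis dominates the
        derivative of \<open>Y (Suc n)\<close>.\<close>
      have "norm (Y (Suc n) t - Y (Suc n) 0) \<le> (K * t) ^ Suc n / fact (Suc n) - (K * 0) ^ Suc n / fact (Suc n)"
      proof (rule differentiable_bound_general[where f' = "\<lambda>s. A s o\<^sub>L Y n s"
            and \<phi>' = "\<lambda>s. K * ((K * s) ^ n / fact n)"])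
        show "continuous_on {0..t} (Y (Suc n))"
          by (rule continuous_on_subset[OF Y_cont]) (use t in auto)
        fix s assume s: "0 < s" "s < t"
        have "(Y (Suc n) has_vector_derivative A s o\<^sub>L Y n s) (at s within {0..T})"
          using s t by (intro Y_deriv) auto
        then show "(Y (Suc n) has_vector_derivative A s o\<^sub>L Y n s) (at s)"
          using s t at_within_interior[of s "{0..T}"] by simp
        have "((\<lambda>s. (K * s) ^ Suc n / fact (Suc n)) has_real_derivative
            (real (Suc n) * (K * s) ^ n * K) / fact (Suc n)) (at s)"
          by (auto intro!: derivative_eq_intros simp del: fact_Suc power_Suc)
        moreover have "(real (Suc n) * (K * s) ^ n * K) / fact (Suc n) = K * ((K * s) ^ n / fact n)"
          by (simp add: divide_simps del: of_nat_Suc)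
        ultimately show "((\<lambda>s. (K * s) ^ Suc n / fact (Suc n)) has_vector_derivative
            K * ((K * s) ^ n / fact n)) (at s)"
          by (simp only: has_real_derivative_iff_has_vector_derivative)
        have "norm (A s o\<^sub>L Y n s) \<le> norm (A s) * norm (Y n s)" by (rule norm_blinfun_compose)
        also have "\<dots> \<le> K * ((K * s) ^ n / fact n)"
          using s t K(1) by (intro mult_mono K Suc.IH) auto
        finally show "norm (A s o\<^sub>L Y n s) \<le> K * ((K * s) ^ n / fact n)" .
      qed (use t in \<open>auto intro!: continuous_intros\<close>)
      then show ?thesis by (simp add: YSuc)
    qed (use K in \<open>simp add: YSuc\<close>)
  qed
  have "norm (Y n t) \<le> (K * T) ^ n / fact n" if "t \<in> {0..T}" for n t
    using Y_le[OF that, of n] that K(1)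
    by (elim order_trans) (auto intro!: divide_right_mono power_mono)
  moreover have "summable (\<lambda>n. (K * T) ^ n / fact n)"
    using summable_exp_generic[of "K * T"] by (simp add: field_simps)
  ultimately have unif: "uniform_limit {0..T} (\<lambda>n t. \<Sum>i<n. Y i t) (\<lambda>t. \<Sum>i. Y i t) sequentially"
    and summ: "\<And>t. t \<in> {0..T} \<Longrightarrow> summable (\<lambda>n. Y n t)"
    by (auto intro!: Weierstrass_m_test intro: summable_comparison_test')
  define G where "G t = (\<Sum>i. Y i t)" for t
  \<comment> \<open>Termwise differentiation of the series without its constant head. Term
    \<open>Suc n\<close> has derivative \<open>A t o\<^sub>L Y n t\<close>, so the differentiated
    sums are \<open>A t\<close> composed with partial sums of \<open>Y\<close>, and their uniform
    convergence follows from that of the series itself.\<close>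
  have "\<exists>g. \<forall>t\<in>{0..T}. (\<lambda>n. Y (Suc n) t) sums g t \<and>
      (g has_derivative (\<lambda>h. h *\<^sub>R (A t o\<^sub>L G t))) (at t within {0..T})"
  proof (rule has_derivative_series[where x = 0])
    show "(Y (Suc n) has_derivative (\<lambda>h. h *\<^sub>R (A t o\<^sub>L Y n t))) (at t within {0..T})"
      if "t \<in> {0..T}" for n t
      using Y_deriv[OF that] by (simp add: has_vector_derivative_def)
    fix e :: real assume "e > 0"
    then have "\<forall>\<^sub>F n in sequentially. \<forall>t\<in>{0..T}. dist (\<Sum>i<n. Y i t) (G t) < e / K"
      using unif K(1) by (simp add: uniform_limit_iff G_def)
    then show "\<forall>\<^sub>F n in sequentially. \<forall>t\<in>{0..T}. \<forall>h.
        norm ((\<Sum>i<n. h *\<^sub>R (A t o\<^sub>L Y i t)) - h *\<^sub>R (A t o\<^sub>L G t)) \<le> e * norm h"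
    proof eventually_elim
      case (elim n)
      show ?case
      proof (intro ballI allI)
        fix t h :: real assume t: "t \<in> {0..T}"
        have "(\<Sum>i<n. h *\<^sub>R (A t o\<^sub>L Y i t)) - h *\<^sub>R (A t o\<^sub>L G t) = h *\<^sub>R (A t o\<^sub>L ((\<Sum>i<n. Y i t) - G t))"
          by (simp add: scaleR_sum_right[symmetric] scaleR_diff_right[symmetric]
              bounded_bilinear.sum_right[OF bounded_bilinear_blinfun_compose]
              bounded_bilinear.diff_right[OF bounded_bilinear_blinfun_compose])
        then have "norm ((\<Sum>i<n. h *\<^sub>R (A t o\<^sub>L Y i t)) - h *\<^sub>R (A t o\<^sub>L G t))
            \<le> \<bar>h\<bar> * (norm (A t) * norm ((\<Sum>i<n. Y i t) - G t))"
          by (simp add: norm_blinfun_compose mult_left_mono)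
        also have "\<dots> \<le> \<bar>h\<bar> * (K * (e / K))"
          using elim t K by (intro mult_left_mono mult_mono) (auto simp: dist_norm intro: less_imp_le)
        finally show "norm ((\<Sum>i<n. h *\<^sub>R (A t o\<^sub>L Y i t)) - h *\<^sub>R (A t o\<^sub>L G t)) \<le> e * norm h"
          using K(1) by (simp add: mult.commute)
      qed
    qed
  next
    show "(0::real) \<in> {0..T}" using T by simp
    show "(\<lambda>n. Y (Suc n) 0) sums 0" by (simp add: YSuc)
  qed simp
  then obtain g where g: "\<And>t. t \<in> {0..T} \<Longrightarrow> (\<lambda>n. Y (Suc n) t) sums g t"
    "\<And>t. t \<in> {0..T} \<Longrightarrow> (g has_vector_derivative A t o\<^sub>L G t) (at t within {0..T})"
    unfolding has_vector_derivative_def by blast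
  have G_eq: "G t = g t + id_blinfun" if "t \<in> {0..T}" for t
    using suminf_split_head[OF summ[OF that]] sums_unique[OF g(1)[OF that]]
    by (simp add: G_def Y0)
  show thesis
  proof
    show "G 0 = id_blinfun"
      using G_eq[of 0] T sums_unique[OF g(1), of 0] by (simp add: YSuc)
    fix t assume t: "t \<in> {0..T}"
    have "((\<lambda>t. g t + id_blinfun) has_vector_derivative A t o\<^sub>L G t) (at t within {0..T})"
      using g(2)[OF t] by (auto intro!: derivative_eq_intros)
    then show "(G has_vector_derivative A t o\<^sub>L G t) (at t within {0..T})"
      by (rule has_vector_derivative_transform[OF t, rotated]) (simp add: G_eq)
  qed
qed

section \<open>Differentiability of the flow map\<close>

lemma has_derivative_of_quadratic_error:
  fixes g :: "'a::real_normed_vector \<Rightarrow> 'b::real_normed_vector"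
  assumes g': "bounded_linear g'"
    and le: "\<And>y. y \<in> X \<Longrightarrow> norm (g y - g x - g' (y - x)) \<le> C * (norm (y - x))\<^sup>2"
  shows "(g has_derivative g') (at x within X)"
  unfolding has_derivative_within_alt
proof (intro conjI allI impI g')
  fix e :: real assume e: "e > 0"
  \<comment> \<open>The absolute value and the summand 1 keep \<open>d\<close> positive whatever the
    sign of \<open>C\<close>.\<close>
  define d where "d = e / (\<bar>C\<bar> + 1)"
  have d: "d > 0" using e by (simp add: d_def)
  show "\<exists>d>0. \<forall>y\<in>X. norm (y - x) < d \<longrightarrow> norm (g y - g x - g' (y - x)) \<le> e * norm (y - x)"
  proof (intro exI[of _ d] conjI d ballI impI)
    fix y assume y: "y \<in> X" "norm (y - x) < d"
    have "norm (g y - g x - g' (y - x)) \<le> C * (norm (y - x))\<^sup>2" by (rule le[OF y(1)])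
    also have "\<dots> \<le> (\<bar>C\<bar> + 1) * (norm (y - x))\<^sup>2" by (intro mult_right_mono) auto
    also have "\<dots> = ((\<bar>C\<bar> + 1) * norm (y - x)) * norm (y - x)" by (simp add: power2_eq_square)
    also have "\<dots> \<le> ((\<bar>C\<bar> + 1) * d) * norm (y - x)"
      using y by (intro mult_right_mono mult_left_mono) auto
    also have "(\<bar>C\<bar> + 1) * d = e" by (simp add: d_def)
    finally show "norm (g y - g x - g' (y - x)) \<le> e * norm (y - x)" .
  qed
qed

text \<open>On the segment from \<open>x\<close> to \<open>y\<close> the derivative differs from
  \<open>DF x\<close> by at most \<open>L * norm (y - x)\<close>, so the mean value inequality for
  the linearisation error gives the bound. The constant is \<open>L\<close> rather than
  \<open>L / 2\<close>, which is enough for differentiability.\<close>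

lemma taylor_lipschitz_derivative:
  fixes F :: "'a::real_normed_vector \<Rightarrow> 'b::real_normed_vector"
  assumes "convex U" and der: "\<And>x. x \<in> U \<Longrightarrow> (F has_derivative blinfun_apply (DF x)) (at x within U)"
    and lip: "L-lipschitz_on U DF" and xy: "x \<in> U" "y \<in> U"
  shows "norm (F y - F x - DF x (y - x)) \<le> L * (norm (y - x))\<^sup>2"
proof -
  have seg: "closed_segment x y \<subseteq> U" using assms by (simp add: closed_segment_subset)
  have "norm (F y - F x - DF x (y - x)) \<le> norm (y - x) * (L * norm (y - x))"
  proof (rule differentiable_bound_linearization[where S = "closed_segment x y"])
    show "x + t *\<^sub>R (y - x) \<in> closed_segment x y" if "t \<in> {0..1}" for t
      using that by (auto simp: in_segment algebra_simps intro!: exI[of _ t])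
    fix w assume w: "w \<in> closed_segment x y"
    show "(F has_derivative blinfun_apply (DF w)) (at w within closed_segment x y)"
      using der seg w has_derivative_subset by blast
    have "onorm (blinfun_apply (DF w) - blinfun_apply (DF x)) = norm (DF w - DF x)"
      by (simp add: norm_blinfun.rep_eq minus_blinfun.rep_eq fun_diff_def)
    also have "\<dots> \<le> L * norm (w - x)"
      using lipschitz_onD[OF lip] seg w xy by (auto simp: dist_norm)
    also have "norm (w - x) \<le> norm (y - x)"
      using segment_bound[OF w] by (simp add: norm_minus_commute)
    finally show "onorm (blinfun_apply (DF w) - blinfun_apply (DF x)) \<le> L * norm (y - x)"
      using lipschitz_on_nonneg[OF lip] by (simp add: mult_left_mono)
  qed simp
  then show ?thesis by (simp add: power2_eq_square mult_ac)
qed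

text \<open>The derivative of the time-\<open>T\<close> map is the fundamental solution of the equation
  linearised along the trajectory.\<close>

lemma flow_map_has_continuous_derivative:
  fixes F :: "'a::euclidean_space \<Rightarrow> 'a" and \<phi> :: "real \<Rightarrow> 'a \<Rightarrow> 'a"
  assumes U: "convex U"
    and dF: "\<And>x. x \<in> U \<Longrightarrow> (F has_derivative blinfun_apply (DF x)) (at x within U)"
    and bdd: "bounded (DF ` U)" and lip: "L-lipschitz_on U DF" and T: "T \<ge> 0"
    and sol: "\<And>z t. z \<in> X \<Longrightarrow> t \<in> {0..T} \<Longrightarrow>
      ((\<lambda>t. \<phi> t z) has_vector_derivative F (\<phi> t z)) (at t within {0..T})"
    and stays: "\<And>z t. z \<in> X \<Longrightarrow> t \<in> {0..T} \<Longrightarrow> \<phi> t z \<in> U"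
    and init: "\<And>z. z \<in> X \<Longrightarrow> \<phi> 0 z = z"
  obtains D where "continuous_on X D"
    "\<And>z. z \<in> X \<Longrightarrow> (\<phi> T has_derivative blinfun_apply (D z)) (at z within X)"
proof -
  obtain K where K: "K > 0" "\<And>x. x \<in> U \<Longrightarrow> norm (DF x) \<le> K"
    using bdd by (auto simp: bounded_pos)
  have L: "L \<ge> 0" using lip by (rule lipschitz_on_nonneg)
  define G where "G = exp ((K + 1) * T)"
  have G: "G > 0" by (simp add: G_def)
  have TT: "T \<in> {0..T}" "0 \<in> {0..T}" using T by auto
  have DF_le: "norm (DF x a) \<le> K * norm a" if "x \<in> U" for x a
    using norm_blinfun[of "DF x" a] K(2)[OF that] mult_right_mono[of "norm (DF x)" K "norm a"] by simp
  have F_lip: "norm (F x - F y) \<le> K * norm (x - y)" if "x \<in> U" "y \<in> U" for x y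
    using differentiable_bound[OF U dF _ that] K(2) by (simp add: norm_blinfun.rep_eq)
  have \<phi>_lip: "norm (\<phi> t z' - \<phi> t z) \<le> G * norm (z' - z)"
    if z: "z \<in> X" "z' \<in> X" and t: "t \<in> {0..T}" for z z' t
  proof -
    have "norm (\<phi> t z' - \<phi> t z) \<le> exp ((K + 1) * T) * (norm (\<phi> 0 z' - \<phi> 0 z) + 0)"
      by (rule gronwall_norm[where E' = "\<lambda>t. F (\<phi> t z') - F (\<phi> t z)" and K = K])
        (use z t K(1) in \<open>auto intro!: has_vector_derivative_diff sol F_lip stays\<close>)
    then show ?thesis using z by (simp add: init G_def)
  qed
  have "\<exists>Y. Y 0 = id_blinfun \<and>
      (\<forall>t\<in>{0..T}. (Y has_vector_derivative DF (\<phi> t z) o\<^sub>L Y t) (at t within {0..T}))"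
    if z: "z \<in> X" for z
  proof (rule linear_ode_fundamental_solution[OF _ T, of "\<lambda>t. DF (\<phi> t z)"])
    show "continuous_on {0..T} (\<lambda>t. DF (\<phi> t z))"
      by (rule continuous_on_compose2[OF lipschitz_on_continuous_on[OF lip]
            continuous_on_vector_derivative[OF sol]])
        (use z stays in auto)
  qed blast
  then obtain Y where Y0: "\<And>z. z \<in> X \<Longrightarrow> Y z 0 = id_blinfun"
    and Y: "\<And>z t. z \<in> X \<Longrightarrow> t \<in> {0..T} \<Longrightarrow>
      (Y z has_vector_derivative DF (\<phi> t z) o\<^sub>L Y z t) (at t within {0..T})"
    by metis
  \<comment> \<open>The Gronwall argument differentiates an inner product, which the operator norm
    does not come from; hence all estimates are made for \<open>Y z t a\<close> with a fixed vector
    \<open>a\<close>.\<close>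
  have Y_apply: "((\<lambda>t. Y z t a) has_vector_derivative DF (\<phi> t z) (Y z t a)) (at t within {0..T})"
    if "z \<in> X" "t \<in> {0..T}" for z t a
    using bounded_linear.has_vector_derivative[OF blinfun.bounded_linear_left Y[OF that], of a]
    by simp
  have Y_le: "norm (Y z t a) \<le> G * norm a" if z: "z \<in> X" and t: "t \<in> {0..T}" for z t a
  proof -
    have "norm (Y z t a) \<le> exp ((K + 1) * T) * (norm (Y z 0 a) + 0)"
      by (rule gronwall_norm[where E' = "\<lambda>t. DF (\<phi> t z) (Y z t a)" and K = K])
        (use z t K(1) in \<open>auto intro!: Y_apply DF_le stays\<close>)
    then show ?thesis using z by (simp add: Y0 G_def)
  qed
  show thesis
  proof
    \<comment> \<open>The difference of two fundamental solutions solves the equation linearised at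
      \<open>z\<close> up to a forcing term. That term is bounded by \<open>?c\<close>, the product
      of \<open>L\<close>, the distance of the trajectories and the size of
      \<open>Y z' t a\<close>.\<close>
    have "norm (Y z T - Y z' T) \<le> (G * (L * (G * G))) * norm (z - z')"
      if z: "z \<in> X" "z' \<in> X" for z z'
    proof (rule norm_blinfun_bound)
      fix a :: 'a
      let ?c = "L * (G * norm (z - z')) * (G * norm a)"
      have "norm (Y z T a - Y z' T a) \<le> exp ((K + 1) * T) * (norm (Y z 0 a - Y z' 0 a) + ?c)"
      proof (rule gronwall_norm[where E' = "\<lambda>t. DF (\<phi> t z) (Y z t a) - DF (\<phi> t z') (Y z' t a)"
            and K = K])
        fix t assume t: "t \<in> {0..T}"
        have "DF (\<phi> t z) (Y z t a) - DF (\<phi> t z') (Y z' t a)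
            = DF (\<phi> t z) (Y z t a - Y z' t a) + (DF (\<phi> t z) - DF (\<phi> t z')) (Y z' t a)"
          by (simp add: blinfun.bilinear_simps)
        also have "norm \<dots> \<le> K * norm (Y z t a - Y z' t a) + ?c"
        proof (rule norm_triangle_mono)
          show "norm (DF (\<phi> t z) (Y z t a - Y z' t a)) \<le> K * norm (Y z t a - Y z' t a)"
            by (intro DF_le stays z t)
          have "norm ((DF (\<phi> t z) - DF (\<phi> t z')) (Y z' t a))
              \<le> norm (DF (\<phi> t z) - DF (\<phi> t z')) * norm (Y z' t a)"
            by (rule norm_blinfun)
          also have "\<dots> \<le> ?c"
          proof (intro mult_mono Y_le z t)
            have "norm (DF (\<phi> t z) - DF (\<phi> t z')) \<le> L * norm (\<phi> t z - \<phi> t z')"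
              using lipschitz_onD[OF lip] stays z t by (simp add: dist_norm)
            also have "\<dots> \<le> L * (G * norm (z - z'))"
              by (intro mult_left_mono \<phi>_lip z t L)
            finally show "norm (DF (\<phi> t z) - DF (\<phi> t z')) \<le> L * (G * norm (z - z'))" .
          qed (use L G in auto)
          finally show "norm ((DF (\<phi> t z) - DF (\<phi> t z')) (Y z' t a)) \<le> ?c" .
        qed
        finally show "norm (DF (\<phi> t z) (Y z t a) - DF (\<phi> t z') (Y z' t a))
            \<le> K * norm (Y z t a - Y z' t a) + ?c" .
      qed (use z TT K(1) L G in \<open>auto intro!: has_vector_derivative_diff Y_apply\<close>)
      then show "norm ((Y z T - Y z' T) a) \<le> G * (L * (G * G)) * norm (z - z') * norm a"
        using z by (simp add: Y0 G_def blinfun.bilinear_simps mult_ac)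
    qed (use L G in auto)
    then have "(G * (L * (G * G)))-lipschitz_on X (\<lambda>z. Y z T)"
      using L G by (intro lipschitz_onI) (auto simp: dist_norm)
    then show "continuous_on X (\<lambda>z. Y z T)" by (rule lipschitz_on_continuous_on)
    fix z assume z: "z \<in> X"
    show "(\<phi> T has_derivative blinfun_apply (Y z T)) (at z within X)"
    proof (rule has_derivative_of_quadratic_error[OF blinfun.bounded_linear_right])
      fix y assume y: "y \<in> X"
      \<comment> \<open>The linearisation error of the trajectory starts at 0 and solves the
        linearised equation up to the Taylor remainder of \<open>F\<close>. Since trajectories
        separate by at most the factor \<open>G\<close>, this remainder is quadratic in
        \<open>y - z\<close>.\<close>
      let ?c = "L * (G * norm (y - z))\<^sup>2"
      have "norm (\<phi> T y - \<phi> T z - Y z T (y - z))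
          \<le> exp ((K + 1) * T) * (norm (\<phi> 0 y - \<phi> 0 z - Y z 0 (y - z)) + ?c)"
      proof (rule gronwall_norm[where E' = "\<lambda>t. F (\<phi> t y) - F (\<phi> t z) - DF (\<phi> t z) (Y z t (y - z))"
            and K = K])
        fix t assume t: "t \<in> {0..T}"
        have "F (\<phi> t y) - F (\<phi> t z) - DF (\<phi> t z) (Y z t (y - z))
            = DF (\<phi> t z) (\<phi> t y - \<phi> t z - Y z t (y - z))
              + (F (\<phi> t y) - F (\<phi> t z) - DF (\<phi> t z) (\<phi> t y - \<phi> t z))"
          by (simp add: blinfun.bilinear_simps)
        also have "norm \<dots> \<le> K * norm (\<phi> t y - \<phi> t z - Y z t (y - z)) + ?c"
        proof (rule norm_triangle_mono)
          show "norm (DF (\<phi> t z) (\<phi> t y - \<phi> t z - Y z t (y - z)))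
              \<le> K * norm (\<phi> t y - \<phi> t z - Y z t (y - z))"
            by (intro DF_le stays z t)
          have "norm (F (\<phi> t y) - F (\<phi> t z) - DF (\<phi> t z) (\<phi> t y - \<phi> t z))
              \<le> L * (norm (\<phi> t y - \<phi> t z))\<^sup>2"
            by (rule taylor_lipschitz_derivative[OF U dF lip]) (use stays y z t in auto)
          also have "\<dots> \<le> ?c"
            by (intro mult_left_mono power_mono \<phi>_lip y z t L) simp
          finally show "norm (F (\<phi> t y) - F (\<phi> t z) - DF (\<phi> t z) (\<phi> t y - \<phi> t z)) \<le> ?c" .
        qed
        finally show "norm (F (\<phi> t y) - F (\<phi> t z) - DF (\<phi> t z) (Y z t (y - z)))
            \<le> K * norm (\<phi> t y - \<phi> t z - Y z t (y - z)) + ?c" .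
      qed (use y z TT K(1) L G in \<open>auto intro!: has_vector_derivative_diff Y_apply sol\<close>)
      then show "norm (\<phi> T y - \<phi> T z - Y z T (y - z)) \<le> (G * (L * G\<^sup>2)) * (norm (y - z))\<^sup>2"
        using y z by (simp add: Y0 init G_def power_mult_distrib mult_ac)
    qed
  qed
qed

section \<open>The least eigenvalue as a minimum of the quadratic form\<close>

lemma sym_matrix_inner_commute:
  fixes A :: "real^'n^'n"
  assumes "transpose A = A"
  shows "x \<bullet> (A *v y) = y \<bullet> (A *v x)"
  by (metis assms dot_lmul_matrix inner_commute transpose_matrix_vector)

lemma continuous_on_quadratic_form:
  fixes A :: "real^'n^'n"
  shows "continuous_on S (\<lambda>z. z \<bullet> (A *v z))"
  by (intro continuous_intros linear_continuous_on linear_linear[THEN iffD2] matrix_vector_mul_linear)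

text \<open>The minimum of the quadratic form on the unit sphere is the least eigenvalue: its
  first variation at a minimiser vanishes.\<close>

lemma rayleigh_minimum_is_least_eigenvalue:
  fixes A :: "real^'n^'n"
  assumes sym: "transpose A = A"
  shows "matrix_eigenvalue A (smallest_eigenvalue A)"
    and "smallest_eigenvalue A * (norm z)\<^sup>2 \<le> z \<bullet> (A *v z)"
proof -
  obtain x where x: "norm x = 1" "\<And>y. norm y = 1 \<Longrightarrow> x \<bullet> (A *v x) \<le> y \<bullet> (A *v y)"
    using continuous_attains_inf[OF compact_sphere _ continuous_on_quadratic_form, of 0 1 A]
    by (auto simp: dist_norm)
  define m where "m = x \<bullet> (A *v x)"
  have le: "m * (norm y)\<^sup>2 \<le> y \<bullet> (A *v y)" for y
  proof (cases "y = 0")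
    case False
    have "m \<le> sgn y \<bullet> (A *v sgn y)"
      unfolding m_def using False by (intro x) (simp add: norm_sgn)
    also have "sgn y \<bullet> (A *v sgn y) = (y \<bullet> (A *v y)) / (norm y)\<^sup>2"
      by (simp add: sgn_div_norm matrix_vector_mult_scaleR power2_eq_square divide_inverse mult_ac)
    finally show ?thesis using False by (simp add: pos_le_divide_eq)
  qed simp
  define w where "w = A *v x - m *\<^sub>R x"
  define q where "q = w \<bullet> (A *v w) - m * (norm w)\<^sup>2"
  \<comment> \<open>The minimiser is varied in the direction of its own eigenvalue residual
    \<open>w\<close>, which makes the linear coefficient a multiple of
    \<open>(norm w)\<^sup>2\<close>.\<close>
  have "0 \<le> 2 * t * (norm w)\<^sup>2 + t\<^sup>2 * q" for t
  proof -
    have "0 \<le> (x + t *\<^sub>R w) \<bullet> (A *v (x + t *\<^sub>R w)) - m * (norm (x + t *\<^sub>R w))\<^sup>2"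
      using le[of "x + t *\<^sub>R w"] by simp
    also have "\<dots> = 2 * t * (w \<bullet> (A *v x) - m * (w \<bullet> x)) + t\<^sup>2 * q"
      using x(1) sym_matrix_inner_commute[OF sym, of x w]
      by (simp add: q_def power2_norm_eq_inner matrix_vector_right_distrib matrix_vector_mult_scaleR
          inner_add inner_commute[of x w] m_def norm_eq_1)
        (simp add: algebra_simps power2_eq_square)
    also have "w \<bullet> (A *v x) - m * (w \<bullet> x) = w \<bullet> w"
      by (subst (3) w_def) (simp add: inner_diff_right)
    finally show ?thesis by (simp add: power2_norm_eq_inner)
  qed
  note quad = this
  have "w = 0"
  proof (rule ccontr)
    assume "w \<noteq> 0"
    then have n: "(norm w)\<^sup>2 > 0" by simp
    \<comment> \<open>At \<open>t = - s\<close> the linear term would outweigh the quadratic one;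
      \<open>\<bar>q\<bar> + 1\<close> bounds \<open>q\<close> and is a safe denominator.\<close>
    define s where "s = (norm w)\<^sup>2 / (\<bar>q\<bar> + 1)"
    have s: "s > 0" using n by (simp add: s_def)
    have "0 \<le> s * (s * q - 2 * (norm w)\<^sup>2)"
      using quad[of "- s"] by (simp add: algebra_simps power2_eq_square)
    then have "2 * (norm w)\<^sup>2 \<le> s * q" using s by (simp add: zero_le_mult_iff)
    also have "\<dots> \<le> s * (\<bar>q\<bar> + 1)" using s by (intro mult_left_mono) auto
    also have "\<dots> = (norm w)\<^sup>2" by (simp add: s_def)
    finally show False using n by simp
  qed
  then have eig: "matrix_eigenvalue A m"
    unfolding matrix_eigenvalue_def using x(1) by (intro exI[of _ x]) (auto simp: w_def)
  have "m \<le> l" if "matrix_eigenvalue A l" for l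
  proof -
    obtain y where y: "y \<noteq> 0" "A *v y = l *\<^sub>R y" using \<open>matrix_eigenvalue A l\<close>
      by (auto simp: matrix_eigenvalue_def)
    then have "m * (norm y)\<^sup>2 \<le> l * (norm y)\<^sup>2" using le[of y] by (simp add: power2_norm_eq_inner)
    then show ?thesis using y by simp
  qed
  then have m: "smallest_eigenvalue A = m"
    unfolding smallest_eigenvalue_def using eig by (intro Least_equality)
  show "matrix_eigenvalue A (smallest_eigenvalue A)" using eig by (simp add: m)
  show "smallest_eigenvalue A * (norm z)\<^sup>2 \<le> z \<bullet> (A *v z)" by (simp add: m le)
qed

lemma smallest_eigenvalue_pos:
  fixes A :: "real^'n^'n"
  assumes "sym_pos_def A"
  shows "smallest_eigenvalue A > 0"
proof -
  obtain x where x: "x \<noteq> 0" "A *v x = smallest_eigenvalue A *\<^sub>R x"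
    using rayleigh_minimum_is_least_eigenvalue(1)[of A] assms
    by (auto simp: sym_pos_def_def matrix_eigenvalue_def)
  have "0 < x \<bullet> (A *v x)" using assms x(1) by (simp add: sym_pos_def_def)
  then have "0 < smallest_eigenvalue A * (x \<bullet> x)" by (simp add: x(2))
  then show ?thesis using inner_ge_zero[of x] by (simp add: zero_less_mult_iff)
qed

section \<open>The energy norm and its balls\<close>

lemma energy_norm_power2:
  assumes "sym_pos_def A"
  shows "(energy_norm A z)\<^sup>2 = z \<bullet> (A *v z)"
proof -
  have "z \<bullet> (A *v z) \<ge> 0"
    using assms by (cases "z = 0") (auto simp: sym_pos_def_def intro: less_imp_le)
  then show ?thesis by (simp add: energy_norm_def)
qed

lemma energy_norm_nonneg:
  assumes "sym_pos_def A"
  shows "energy_norm A z \<ge> 0"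
  using assms by (cases "z = 0") (auto simp: energy_norm_def sym_pos_def_def intro: less_imp_le)

lemma energy_norm_scaleR: "energy_norm A (c *\<^sub>R z) = \<bar>c\<bar> * energy_norm A z"
  by (simp add: energy_norm_def matrix_vector_mult_scaleR real_sqrt_mult mult.assoc[symmetric])

lemma smallest_eigenvalue_le_energy_norm:
  assumes "sym_pos_def A"
  shows "smallest_eigenvalue A * (norm z)\<^sup>2 \<le> (energy_norm A z)\<^sup>2"
  using rayleigh_minimum_is_least_eigenvalue(2)[of A z] assms
  by (simp add: energy_norm_power2 sym_pos_def_def)

lemma norm_le_energy_norm:
  assumes "sym_pos_def A"
  shows "norm z \<le> energy_norm A z / sqrt (smallest_eigenvalue A)"
proof -
  have "sqrt (smallest_eigenvalue A * (norm z)\<^sup>2) \<le> energy_norm A z"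
    by (rule real_le_lsqrt[OF energy_norm_nonneg smallest_eigenvalue_le_energy_norm]) (fact assms)+
  then show ?thesis
    using smallest_eigenvalue_pos[OF assms] by (simp add: real_sqrt_mult pos_le_divide_eq mult.commute)
qed

lemma continuous_on_energy_norm: "continuous_on S (energy_norm A)"
  unfolding energy_norm_def by (intro continuous_intros continuous_on_quadratic_form)

lemma open_energy_ball: "open {z. energy_norm A z < R}"
  by (rule open_Collect_less) (auto intro: continuous_on_energy_norm)

text \<open>The quadratic form at a convex combination equals the combination of its values minus
  \<open>s * t\<close> times its value at \<open>x - y\<close>, which is nonnegative. Comparing with
  the larger of the two norms keeps the inequality strict.\<close>

lemma convex_energy_ball:
  assumes A: "sym_pos_def A"
  shows "convex {z. energy_norm A z < R}"
proof (rule convexI)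
  fix x y and s t :: real
  assume xy: "x \<in> {z. energy_norm A z < R}" "y \<in> {z. energy_norm A z < R}"
    and st: "0 \<le> s" "0 \<le> t" "s + t = 1"
  define M where "M = max (energy_norm A x) (energy_norm A y)"
  have M: "M < R" "M \<ge> 0" using xy energy_norm_nonneg[OF A] by (auto simp: M_def le_max_iff_disj)
  have t: "t = 1 - s" using st by simp
  have sq: "z \<bullet> (A *v z) \<le> M\<^sup>2" if "energy_norm A z \<le> M" for z
    using power_mono[OF that energy_norm_nonneg[OF A], of 2] by (simp add: energy_norm_power2[OF A])
  have "(s *\<^sub>R x + t *\<^sub>R y) \<bullet> (A *v (s *\<^sub>R x + t *\<^sub>R y))
      = s * (x \<bullet> (A *v x)) + t * (y \<bullet> (A *v y)) - s * t * ((x - y) \<bullet> (A *v (x - y)))"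
    using sym_matrix_inner_commute[of A x y] A
    by (simp add: t matrix_vector_right_distrib matrix_vector_mult_diff_distrib
        matrix_vector_mult_scaleR inner_add inner_diff sym_pos_def_def)
      (simp add: algebra_simps)
  also have "\<dots> \<le> s * (x \<bullet> (A *v x)) + t * (y \<bullet> (A *v y))"
    using st by (simp add: energy_norm_power2[OF A, symmetric])
  also have "\<dots> \<le> s * M\<^sup>2 + t * M\<^sup>2"
    using st by (intro add_mono mult_left_mono sq) (auto simp: M_def)
  also have "\<dots> = M\<^sup>2" by (simp add: t algebra_simps)
  finally have "(energy_norm A (s *\<^sub>R x + t *\<^sub>R y))\<^sup>2 \<le> M\<^sup>2"
    by (simp add: energy_norm_power2[OF A])
  then have "energy_norm A (s *\<^sub>R x + t *\<^sub>R y) \<le> M" by (rule power2_le_imp_le) (fact M)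
  then show "s *\<^sub>R x + t *\<^sub>R y \<in> {z. energy_norm A z < R}" using M by simp
qed

text \<open>A point of the closed ball is the limit of its multiples by factors below 1, and these
  lie in the open ball because \<open>R\<close> is positive.\<close>

lemma closure_energy_ball:
  assumes A: "sym_pos_def A" and R: "R > 0"
  shows "closure {z. energy_norm A z < R} = {z. energy_norm A z \<le> R}"
proof
  have "closed {z. energy_norm A z \<le> R}"
    by (rule closed_Collect_le) (auto intro: continuous_on_energy_norm)
  then show "closure {z. energy_norm A z < R} \<subseteq> {z. energy_norm A z \<le> R}"
    by (intro closure_minimal) auto
  show "{z. energy_norm A z \<le> R} \<subseteq> closure {z. energy_norm A z < R}"
  proof
    fix z assume z: "z \<in> {z. energy_norm A z \<le> R}"
    define s where "s n = 1 - inverse (real (Suc n))" for n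
    have "(\<lambda>n. s n *\<^sub>R z) \<longlonglongrightarrow> (1 - 0) *\<^sub>R z"
      unfolding s_def by (intro tendsto_intros LIMSEQ_inverse_real_of_nat)
    moreover have "s n *\<^sub>R z \<in> {z. energy_norm A z < R}" for n
    proof -
      have s: "0 \<le> s n" "s n < 1" by (auto simp: s_def field_simps)
      then have "energy_norm A (s n *\<^sub>R z) \<le> s n * R"
        using z by (auto simp: energy_norm_scaleR intro: mult_left_mono)
      also have "\<dots> < R" using s R by simp
      finally show ?thesis by simp
    qed
    ultimately show "z \<in> closure {z. energy_norm A z < R}"
      unfolding closure_sequential by (intro exI[of _ "\<lambda>n. s n *\<^sub>R z"]) auto
  qed
qed

lemma compact_energy_ball:
  assumes A: "sym_pos_def A"
  shows "compact {z. energy_norm A z \<le> R}"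
  unfolding compact_eq_bounded_closed
proof
  show "closed {z. energy_norm A z \<le> R}"
    by (rule closed_Collect_le) (auto intro: continuous_on_energy_norm)
  show "bounded {z. energy_norm A z \<le> R}"
  proof (rule boundedI)
    fix z assume "z \<in> {z. energy_norm A z \<le> R}"
    then show "norm z \<le> R / sqrt (smallest_eigenvalue A)"
      using norm_le_energy_norm[OF A, of z] smallest_eigenvalue_pos[OF A]
      by (auto elim!: order_trans intro!: divide_right_mono)
  qed
qed

section \<open>Energy balance of the nudged difference\<close>

text \<open>To be read with \<open>w = v - u\<close>, \<open>dN\<close> the difference of the
  nonlinear terms and \<open>r\<close> the model error at \<open>v\<close>. Writing
  \<open>Iw = w - (w - Iw)\<close>, nudging yields damping \<open>\<mu>\<close> at the price of
  \<open>\<mu> * k\<^sup>2\<close> times the squared energy norm. Viscosity pays this and retains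
  twice the effective viscosity, one half of which absorbs the contribution of
  \<open>\<delta>\<close>.\<close>

lemma nudging_dissipation:
  fixes A :: "real^'n^'n"
  assumes A: "sym_pos_def A" and mono: "- (dN \<bullet> w) \<le> Cm * (norm w)\<^sup>2"
    and interp: "norm (w - Iw) \<le> k * energy_norm A w"
    and r: "norm r \<le> \<delta> + l * norm w" and mu: "\<mu> > 0" "\<mu> * k\<^sup>2 < 2 * \<nu>"
  shows "2 * ((r - \<nu> *\<^sub>R (A *v w) - dN - \<mu> *\<^sub>R Iw) \<bullet> w)
    \<le> - (\<mu> - 2 * (Cm + l)) * (norm w)\<^sup>2 + \<delta>\<^sup>2 / (smallest_eigenvalue A * (\<nu> - \<mu> * k\<^sup>2 / 2))"
proof -
  define V where "V = energy_norm A w"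
  define e where "e = \<nu> - \<mu> * k\<^sup>2 / 2"
  define a where "a = smallest_eigenvalue A * e"
  have e: "e > 0" using mu by (simp add: e_def)
  have a: "a > 0" using e smallest_eigenvalue_pos[OF A] by (simp add: a_def)
  have Aw: "(A *v w) \<bullet> w = V\<^sup>2" by (simp add: V_def energy_norm_power2[OF A] inner_commute)
  have "r \<bullet> w \<le> norm r * norm w" by (rule norm_cauchy_schwarz)
  also have "\<dots> \<le> (\<delta> + l * norm w) * norm w" by (intro mult_right_mono r) simp
  finally have rw: "r \<bullet> w \<le> \<delta> * norm w + l * (norm w)\<^sup>2"
    by (simp add: algebra_simps power2_eq_square)
  have "(w - Iw) \<bullet> w \<le> norm (w - Iw) * norm w" by (rule norm_cauchy_schwarz)
  also have "\<dots> \<le> (k * V) * norm w" using interp by (intro mult_right_mono) (auto simp: V_def)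
  finally have "2 * ((w - Iw) \<bullet> w) \<le> (k * V)\<^sup>2 + (norm w)\<^sup>2"
    using sum_squares_bound[of "k * V" "norm w"] by simp
  then have "2 * (- (Iw \<bullet> w)) \<le> k\<^sup>2 * V\<^sup>2 - (norm w)\<^sup>2"
    by (simp add: inner_diff_left power2_norm_eq_inner power_mult_distrib)
  then have Iw: "\<mu> * (2 * (- (Iw \<bullet> w))) \<le> \<mu> * (k\<^sup>2 * V\<^sup>2 - (norm w)\<^sup>2)"
    using mu by (intro mult_left_mono) auto
  \<comment> \<open>Young's inequality with weight \<open>a\<close>, chosen so that the eigenvalue
    bound turns \<open>a * (norm w)\<^sup>2\<close> into at most
    \<open>e * V\<^sup>2\<close>.\<close>
  have "2 * (\<delta> / sqrt a) * (sqrt a * norm w) \<le> (\<delta> / sqrt a)\<^sup>2 + (sqrt a * norm w)\<^sup>2"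
    by (rule sum_squares_bound)
  then have "2 * (\<delta> * norm w) \<le> \<delta>\<^sup>2 / a + a * (norm w)\<^sup>2"
    using a by (simp add: power_divide power_mult_distrib mult.assoc)
  also have "a * (norm w)\<^sup>2 \<le> e * V\<^sup>2"
    using mult_left_mono[OF smallest_eigenvalue_le_energy_norm[OF A, of w], of e] e
    by (simp add: a_def V_def mult_ac)
  finally have dw: "2 * (\<delta> * norm w) \<le> \<delta>\<^sup>2 / a + e * V\<^sup>2" by simp
  have eV: "e * V\<^sup>2 \<ge> 0" using e by simp
  have "2 * ((r - \<nu> *\<^sub>R (A *v w) - dN - \<mu> *\<^sub>R Iw) \<bullet> w)
      = 2 * (r \<bullet> w) - 2 * \<nu> * V\<^sup>2 - 2 * (dN \<bullet> w) + \<mu> * (2 * (- (Iw \<bullet> w)))"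
    by (simp add: inner_diff_left Aw)
  also have "\<dots> \<le> (\<delta>\<^sup>2 / a + e * V\<^sup>2) + 2 * l * (norm w)\<^sup>2 - 2 * \<nu> * V\<^sup>2
      + 2 * Cm * (norm w)\<^sup>2 + \<mu> * (k\<^sup>2 * V\<^sup>2 - (norm w)\<^sup>2)"
    using rw dw Iw mono by linarith
  also have "\<dots> = - (\<mu> - 2 * (Cm + l)) * (norm w)\<^sup>2 + \<delta>\<^sup>2 / a - e * V\<^sup>2"
    by (simp add: e_def algebra_simps)
  also have "\<dots> \<le> - (\<mu> - 2 * (Cm + l)) * (norm w)\<^sup>2 + \<delta>\<^sup>2 / a" using eV by simp
  finally show ?thesis by (simp only: a_def e_def)
qed

section \<open>Derivatives, suprema and Lipschitz constants on a set\<close>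

lemma C1_derivative_works:
  assumes "C1_on K g"
  shows "has_C1_derivative_on g (C1_derivative K g) K"
  using assms unfolding C1_on_def C1_derivative_def by (rule someI_ex)

text \<open>Compactness and continuity bound the set of norms, without which its real supremum would
  carry no information.\<close>

lemma norm_le_sup_norm_on:
  assumes "compact K" "continuous_on K g" "z \<in> K"
  shows "norm (g z) \<le> sup_norm_on K g"
  unfolding sup_norm_on_def
proof (rule cSUP_upper[OF assms(3)])
  show "bdd_above ((\<lambda>z. norm (g z)) ` K)"
    by (intro bounded_imp_bdd_above compact_imp_bounded compact_continuous_image
        continuous_intros assms)
qed

lemma sup_norm_on_le:
  assumes "K \<noteq> {}" "\<And>z. z \<in> K \<Longrightarrow> norm (g z) \<le> c"
  shows "sup_norm_on K g \<le> c"
  unfolding sup_norm_on_def using assms by (rule cSUP_least)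

text \<open>Two distinct points are needed, as otherwise the supremum is over the empty set.\<close>

lemma lipschitz_const_on_le:
  assumes "L-lipschitz_on K g" "x \<in> K" "y \<in> K" "x \<noteq> y"
  shows "lipschitz_const_on K g \<le> L"
  unfolding lipschitz_const_on_def
proof (rule cSUP_least)
  show "{(z, z'). z \<in> K \<and> z' \<in> K \<and> z \<noteq> z'} \<noteq> {}" using assms by auto
  fix p assume "p \<in> {(z, z'). z \<in> K \<and> z' \<in> K \<and> z \<noteq> z'}"
  then show "(case p of (z, z') \<Rightarrow> norm (g z' - g z) / norm (z' - z)) \<le> L"
    using lipschitz_onD[OF assms(1)] by (auto simp: dist_norm divide_le_eq norm_minus_commute)
qed

text \<open>The constant \<open>L\<close> only serves to bound the difference quotients, so that
  their supremum is a true upper bound.\<close>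

lemma norm_diff_le_lipschitz_const_on:
  assumes lip: "L-lipschitz_on K g" and z: "z \<in> K" "z' \<in> K"
  shows "norm (g z' - g z) \<le> lipschitz_const_on K g * norm (z' - z)"
proof (cases "z = z'")
  case False
  have "norm (g z' - g z) / norm (z' - z) \<le> lipschitz_const_on K g"
    unfolding lipschitz_const_on_def
  proof (rule cSUP_upper2[where x = "(z, z')"])
    show "bdd_above ((\<lambda>(z, z'). norm (g z' - g z) / norm (z' - z)) `
        {(z, z'). z \<in> K \<and> z' \<in> K \<and> z \<noteq> z'})"
      using lipschitz_onD[OF lip]
      by (intro bdd_aboveI[of _ L]) (auto simp: dist_norm divide_le_eq norm_minus_commute)
  qed (use z False in auto)
  then show ?thesis using False by (simp add: divide_le_eq)
qed simp

section \<open>Model error bounds and the tracking estimate\<close>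

theorem proposition4p3:
  fixes A B :: "real^'d^'d" and f :: "real^'d" and N F :: "real^'d \<Rightarrow> real^'d"
    and \<nu> \<alpha> \<beta> C\<^sub>E c0 C\<^sub>I h \<mu> R_ext R_ext_plus Rstar Rstar_plus dt lam1 C_sq :: real
    and C :: "real \<Rightarrow> real" and I :: "real \<Rightarrow> real^'d \<Rightarrow> real^'d" and \<psi> :: "real \<Rightarrow> real"
    and S :: "real \<Rightarrow> real^'d \<Rightarrow> real^'d" and Shat Fhat F\<^sub>M r\<^sub>M :: "real^'d \<Rightarrow> real^'d"
    and Bstar Bstar_plus :: "(real^'d) set" and DF :: "real^'d \<Rightarrow> ((real^'d) \<Rightarrow>\<^sub>L (real^'d))"
    and \<epsilon> \<eta> \<delta> ell :: real
  \<comment> \<open>structural assumptions\<close>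
  assumes nu: "\<nu> > 0"
    and F_eq: "F = (\<lambda>z. f - \<nu> *\<^sub>R (A *v z) - N z)"
    and A_spd: "sym_pos_def A" and lam1_eq: "lam1 = smallest_eigenvalue A"
    and coercive: "\<alpha> > 0" "\<beta> \<ge> 0"
      "\<forall>z. \<nu> * (z \<bullet> (A *v z)) + N z \<bullet> z \<ge> \<alpha> * (norm z)\<^sup>2 - \<beta>"
    and N_lip: "local_lipschitz (UNIV :: real set) UNIV (\<lambda>_. N)"
    and energy: "C\<^sub>E \<ge> 0" "\<forall>z. N z \<bullet> z \<ge> - C\<^sub>E * (norm z)\<^sup>2"
    and local_mono: "\<forall>R>0. C R \<ge> 0 \<and> (\<forall>z z'. norm z \<le> R \<longrightarrow> norm z' \<le> R \<longrightarrow>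
        - ((N z' - N z) \<bullet> (z' - z)) \<le> C R * (norm (z' - z))\<^sup>2)"
    and interp: "c0 > 0" "C\<^sub>I > 0"
      "\<forall>h'\<in>{0..1}. linear (I h') \<and> (\<forall>z. norm (z - I h' z) \<le> c0 * h' * energy_norm A z)
         \<and> (\<forall>z. norm (I h' z) \<le> C\<^sub>I * norm z)"
    and h: "h \<in> {0..1}"
    and S_flow: "\<forall>z. ode_solution (\<lambda>_. F) (\<lambda>t. S t z) \<and> S 0 z = z"
  \<comment> \<open>cutoff assumptions\<close>
    and R_ext: "R_ext > 0" "R_ext_plus > R_ext"
    and psi: "smooth_real_on {0..} \<psi>" "\<forall>r\<ge>0. \<psi> r \<in> {0..1}"
      "\<forall>r\<ge>0. r \<le> R_ext\<^sup>2 \<longrightarrow> \<psi> r = 1" "\<forall>r\<ge>R_ext_plus\<^sup>2. \<psi> r = 0"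
    and mu: "\<mu> > 0"
    and B_spd: "sym_pos_def B" "smallest_eigenvalue B - \<mu> * C\<^sub>I > 0"
    and Shat_lip: "\<exists>U. open U \<and> {z. energy_norm A z \<le> R_ext_plus} \<subseteq> U \<and>
        local_lipschitz (UNIV :: real set) U (\<lambda>_. Shat)"
    and Fhat_eq: "Fhat = (\<lambda>z. (Shat z - z) /\<^sub>R dt)"
    and FM_eq: "F\<^sub>M = cutoff_extension \<psi> A B f Fhat"
  \<comment> \<open>post-absorption ball\<close>
    and Rstar: "0 < Rstar" "Rstar \<le> R_ext"
    and Bstar_eq: "Bstar = {z. energy_norm A z \<le> Rstar}"
    and C_sq_eq: "C_sq = C (Rstar / sqrt lam1)"
  \<comment> \<open>hypotheses of the proposition\<close>
    and dt: "dt > 0"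
    and Rstar_plus: "Rstar_plus > Rstar"
    and Bstar_plus_eq: "Bstar_plus = {z. energy_norm A z < Rstar_plus}"
    and S_stays: "\<forall>z\<in>Bstar. \<forall>\<tau>\<in>{0..dt}. S \<tau> z \<in> Bstar_plus"
    and F_C1: "C1_on (closure Bstar_plus) F" and DF_eq: "DF = C1_derivative (closure Bstar_plus) F"
    and F_bdd: "bounded (F ` closure Bstar_plus)" "bounded (DF ` closure Bstar_plus)"
    and DF_lip: "\<exists>L. L-lipschitz_on (closure Bstar_plus) DF"
    and Shat_C1: "C1_on Bstar Shat"
    and eps_eq: "\<epsilon> = sup_norm_on Bstar (\<lambda>z. Shat z - S dt z)"
    and eta_eq: "\<eta> = sup_norm_on Bstar (\<lambda>z. C1_derivative Bstar Shat z - C1_derivative Bstar (S dt) z)"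
    and r_eq: "r\<^sub>M = (\<lambda>z. F\<^sub>M z - F z)"
    and delta_eq: "\<delta> = sup_norm_on Bstar r\<^sub>M"
    and ell_eq: "ell = lipschitz_const_on Bstar r\<^sub>M"
  shows "C1_on Bstar (S dt) \<and>
    (\<exists>C_flow. flow_consistency_bound Bstar F DF (S dt) dt C_flow) \<and>
    (\<forall>z\<in>Bstar. F\<^sub>M z = Fhat z) \<and>
    (\<forall>C_flow. flow_consistency_bound Bstar F DF (S dt) dt C_flow \<longrightarrow>
       \<delta> \<le> \<epsilon> / dt + C_flow * dt \<and>
       ell \<le> \<eta> / dt + C_flow * dt \<and>
       (\<mu> > 2 * (C_sq + \<eta> / dt + C_flow * dt) \<and> \<mu> * c0\<^sup>2 * h\<^sup>2 < \<nu> \<longrightarrow>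
          \<mu> > 2 * (C_sq + ell) \<and>
          (let \<gamma> = \<mu> - 2 * (C_sq + ell); \<nu>_eff = \<nu> - \<mu> * c0\<^sup>2 * h\<^sup>2 / 2 in
           \<forall>u v Tstar. ode_solution (\<lambda>_. F) u \<and>
              ode_solution (\<lambda>t x. F\<^sub>M x - \<mu> *\<^sub>R (I h x - I h (u t))) v \<and>
              Tstar \<ge> 0 \<and> (\<forall>t\<ge>Tstar. u t \<in> Bstar \<and> v t \<in> Bstar) \<longrightarrow>
              (\<forall>t\<ge>Tstar. (norm (v t - u t))\<^sup>2 \<le>
                 exp (- \<gamma> * (t - Tstar)) * (norm (v Tstar - u Tstar))\<^sup>2 +
                 \<delta>\<^sup>2 / (lam1 * \<nu>_eff * \<gamma>) * (1 - exp (- \<gamma> * (t - Tstar)))))))"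
proof -
  \<comment> \<open>\<open>L Cf\<close> is the bound to be reached by \<open>ell\<close>;
    \<open>K0\<close> is the open ball, on which \<open>Shat\<close> and \<open>S dt\<close> have
    derivatives in the full sense.\<close>
  define L where "L Cf = \<eta> / dt + Cf * dt" for Cf
  define K0 where "K0 = {z. energy_norm A z < Rstar}"
  have lam1: "lam1 > 0" using smallest_eigenvalue_pos[OF A_spd] by (simp add: lam1_eq)
  have closure_K0: "closure K0 = Bstar"
    using closure_energy_ball[OF A_spd Rstar(1)] by (simp add: K0_def Bstar_eq)
  have K0: "open K0" "convex K0" "K0 \<subseteq> Bstar"
    by (auto simp: K0_def Bstar_eq open_energy_ball convex_energy_ball[OF A_spd])
  have K0_interior: "K0 \<subseteq> interior Bstar" by (rule interior_maximal) (fact K0)+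
  have compact: "compact Bstar" unfolding Bstar_eq by (rule compact_energy_ball[OF A_spd])
  have Bstar_sub: "Bstar \<subseteq> Bstar_plus"
    using Rstar_plus by (auto simp: Bstar_eq Bstar_plus_eq)
  have Bstar_plus_sub: "Bstar_plus \<subseteq> interior (closure Bstar_plus)"
    unfolding Bstar_plus_eq by (intro interior_maximal closure_subset open_energy_ball)
  have zero: "0 \<in> Bstar" using Rstar by (simp add: Bstar_eq energy_norm_def)
  \<comment> \<open>A nonzero point of the ball, needed besides 0 for the supremum in
    \<open>ell\<close> to range over a nonempty set. A basis vector is shrunk; the summand 1 in the
    denominator makes it positive at once.\<close>
  obtain b :: "real^'d" where b: "b \<in> Bstar" "b \<noteq> 0"
  proof -
    obtain b0 :: "real^'d" where "b0 \<in> Basis" using nonempty_Basis by blast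
    then have b0: "b0 \<noteq> 0" by (rule nonzero_Basis)
    define s where "s = Rstar / (energy_norm A b0 + 1)"
    have "s > 0" using Rstar energy_norm_nonneg[OF A_spd, of b0] by (simp add: s_def add_nonneg_pos)
    moreover have "s * energy_norm A b0 \<le> Rstar"
      using Rstar energy_norm_nonneg[OF A_spd, of b0]
      by (simp add: s_def pos_divide_le_eq add_nonneg_pos mult_left_mono)
    ultimately show thesis using b0 by (intro that[of "s *\<^sub>R b0"]) (auto simp: Bstar_eq energy_norm_scaleR)
  qed

  \<comment> \<open>Continuous differentiability of the flow map on the ball\<close>
  have F_der: "continuous_on (closure Bstar_plus) F" "continuous_on (closure Bstar_plus) DF"
    "\<And>x. x \<in> Bstar_plus \<Longrightarrow> (F has_derivative blinfun_apply (DF x)) (at x)"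
    using C1_derivative_works[OF F_C1] Bstar_plus_sub
    by (auto simp: has_C1_derivative_on_def DF_eq)
  have F_cont: "continuous_on Bstar F" "continuous_on Bstar DF"
    using F_der(1,2) Bstar_sub closure_subset[of Bstar_plus] by (blast intro: continuous_on_subset)+
  obtain M where M: "M-lipschitz_on (closure Bstar_plus) DF" using DF_lip by blast
  obtain D where D: "continuous_on Bstar D"
    "\<And>z. z \<in> Bstar \<Longrightarrow> (S dt has_derivative blinfun_apply (D z)) (at z within Bstar)"
  proof (rule flow_map_has_continuous_derivative[of Bstar_plus F DF M dt Bstar S])
    show "convex Bstar_plus" unfolding Bstar_plus_eq by (rule convex_energy_ball[OF A_spd])
    show "bounded (DF ` Bstar_plus)"
      by (rule bounded_subset[OF F_bdd(2)]) (intro image_mono closure_subset)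
    show "M-lipschitz_on Bstar_plus DF" by (rule lipschitz_on_subset[OF M closure_subset])
    show "((\<lambda>t. S t z) has_vector_derivative F (S t z)) (at t within {0..dt})"
      if "t \<in> {0..dt}" for z t
    proof (rule has_vector_derivative_within_subset)
      show "((\<lambda>t. S t z) has_vector_derivative F (S t z)) (at t within {0..})"
        using S_flow that by (simp add: ode_solution_def)
    qed auto
    show "(F has_derivative blinfun_apply (DF x)) (at x within Bstar_plus)" if "x \<in> Bstar_plus" for x
      using F_der(3)[OF that] by (rule has_derivative_at_withinI)
  qed (use S_stays S_flow dt in auto)
  \<comment> \<open>The flow argument gives derivatives relative to the closed ball; at interior
    points these are derivatives in the full sense.\<close>
  have S_C1: "C1_on Bstar (S dt)"
    unfolding C1_on_def has_C1_derivative_on_def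
  proof (intro exI[of _ D] conjI ballI D(1))
    show "continuous_on Bstar (S dt)" using D(2) by (rule has_derivative_continuous_on)
    fix x assume x: "x \<in> interior Bstar"
    then have "x \<in> Bstar" using interior_subset by blast
    from D(2)[OF this] show "(S dt has_derivative blinfun_apply (D x)) (at x)"
      by (simp only: at_within_interior[OF x])
  qed
  \<comment> \<open>\<open>C1_derivative\<close> is a choice, so \<open>DS\<close> is used through
    the properties of any such derivative and is not identified with \<open>D\<close>.\<close>
  define DS DSh where "DS = C1_derivative Bstar (S dt)" and "DSh = C1_derivative Bstar Shat"
  have S_der: "continuous_on Bstar (S dt)" "continuous_on Bstar DS"
    "\<And>x. x \<in> K0 \<Longrightarrow> (S dt has_derivative blinfun_apply (DS x)) (at x)"
    using C1_derivative_works[OF S_C1] K0_interior by (auto simp: has_C1_derivative_on_def DS_def)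
  have Sh_der: "continuous_on Bstar Shat" "continuous_on Bstar DSh"
    "\<And>x. x \<in> K0 \<Longrightarrow> (Shat has_derivative blinfun_apply (DSh x)) (at x)"
    using C1_derivative_works[OF Shat_C1] K0_interior by (auto simp: has_C1_derivative_on_def DSh_def)

  \<comment> \<open>Existence of a consistency constant\<close>
  have flow: "\<exists>Cf. flow_consistency_bound Bstar F DF (S dt) dt Cf"
  proof -
    \<comment> \<open>Both defects have finite suprema on the compact ball. As \<open>dt\<close> is
      fixed and positive, dividing the larger one by \<open>dt\<^sup>2\<close> gives the required
      form.\<close>
    define c1 c2 where "c1 = sup_norm_on Bstar (\<lambda>z. S dt z - z - dt *\<^sub>R F z)"
      and "c2 = sup_norm_on Bstar (\<lambda>z. DS z - id_blinfun - dt *\<^sub>R DF z)"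
    have "norm (S dt z - z - dt *\<^sub>R F z) \<le> c1" "norm (DS z - id_blinfun - dt *\<^sub>R DF z) \<le> c2"
      if "z \<in> Bstar" for z
      unfolding c1_def c2_def
      by (rule norm_le_sup_norm_on[OF compact _ that], intro continuous_intros S_der F_cont)+
    then have "flow_consistency_bound Bstar F DF (S dt) dt (max c1 c2 / dt\<^sup>2)"
      unfolding flow_consistency_bound_def DS_def[symmetric] using dt by (auto simp: le_max_iff_disj)
    then show ?thesis ..
  qed

  \<comment> \<open>Size and Lipschitz constant of the model error\<close>
  have FM: "F\<^sub>M z = Fhat z" if "z \<in> Bstar" for z
  proof -
    have "energy_norm A z \<le> R_ext" using that Rstar by (simp add: Bstar_eq)
    then have "(energy_norm A z)\<^sup>2 \<le> R_ext\<^sup>2"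
      by (intro power_mono energy_norm_nonneg[OF A_spd])
    then have "\<psi> ((energy_norm A z)\<^sup>2) = 1" using psi(3) by simp
    then show ?thesis by (simp add: FM_eq cutoff_extension_def)
  qed
  \<comment> \<open>Inserting the exact map \<open>S dt\<close> separates the error of the learned
    map from the Euler defect of the exact flow.\<close>
  have r_split: "r\<^sub>M z = (Shat z - S dt z) /\<^sub>R dt + (S dt z - z - dt *\<^sub>R F z) /\<^sub>R dt" if "z \<in> Bstar" for z
    using dt FM[OF that] by (simp add: r_eq Fhat_eq algebra_simps)
  have r_cont: "continuous_on Bstar r\<^sub>M"
    by (subst continuous_on_cong[OF refl r_split])
      (auto intro!: continuous_intros S_der Sh_der F_cont)
  have r_le: "norm (r\<^sub>M z) \<le> \<delta>" if "z \<in> Bstar" for z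
    unfolding delta_eq by (rule norm_le_sup_norm_on[OF compact r_cont that])

  have delta_le: "\<delta> \<le> \<epsilon> / dt + Cf * dt"
    if Cf: "flow_consistency_bound Bstar F DF (S dt) dt Cf" for Cf
    unfolding delta_eq
  proof (rule sup_norm_on_le)
    fix z assume z: "z \<in> Bstar"
    have "norm (Shat z - S dt z) \<le> \<epsilon>"
      unfolding eps_eq by (rule norm_le_sup_norm_on[OF compact _ z]) (intro continuous_intros S_der Sh_der)
    moreover have "norm (S dt z - z - dt *\<^sub>R F z) \<le> Cf * dt\<^sup>2"
      using Cf z by (simp add: flow_consistency_bound_def)
    ultimately have "norm ((Shat z - S dt z) /\<^sub>R dt) + norm ((S dt z - z - dt *\<^sub>R F z) /\<^sub>R dt)
        \<le> \<epsilon> / dt + (Cf * dt\<^sup>2) / dt"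
      using dt by (intro add_mono) (auto simp: divide_inverse mult.commute intro!: mult_left_mono)
    then show "norm (r\<^sub>M z) \<le> \<epsilon> / dt + Cf * dt"
      unfolding r_split[OF z] using dt norm_triangle_ineq
      by (smt (verit) power2_eq_square nonzero_mult_div_cancel_right mult.assoc)
  qed (use zero in auto)

  have lip: "(L Cf)-lipschitz_on Bstar r\<^sub>M"
    if Cf: "flow_consistency_bound Bstar F DF (S dt) dt Cf" for Cf
    unfolding closure_K0[symmetric]
  proof (rule lipschitz_on_closure)
    \<comment> \<open>The derivative of the split form of \<open>r\<^sub>M\<close>. It is bounded by
      \<open>L Cf\<close> on the whole closed ball, and its bound at 0 also shows that
      \<open>L Cf\<close> is nonnegative.\<close>
    define Dr where "Dr z = (DSh z - DS z) /\<^sub>R dt + (DS z - id_blinfun - dt *\<^sub>R DF z) /\<^sub>R dt" for z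
    have Dr_le: "norm (Dr z) \<le> L Cf" if z: "z \<in> Bstar" for z
    proof -
      have "norm (DSh z - DS z) \<le> \<eta>"
        unfolding eta_eq DS_def[symmetric] DSh_def[symmetric]
        by (rule norm_le_sup_norm_on[OF compact _ z]) (intro continuous_intros S_der Sh_der)
      moreover have "norm (DS z - id_blinfun - dt *\<^sub>R DF z) \<le> Cf * dt\<^sup>2"
        using Cf z by (simp add: flow_consistency_bound_def DS_def)
      ultimately have "norm ((DSh z - DS z) /\<^sub>R dt) + norm ((DS z - id_blinfun - dt *\<^sub>R DF z) /\<^sub>R dt)
          \<le> \<eta> / dt + (Cf * dt\<^sup>2) / dt"
        using dt by (intro add_mono) (auto simp: divide_inverse mult.commute intro!: mult_left_mono)
      then show ?thesis
        unfolding Dr_def L_def using dt norm_triangle_ineq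
        by (smt (verit) power2_eq_square nonzero_mult_div_cancel_right mult.assoc)
    qed
    show "(L Cf)-lipschitz_on K0 r\<^sub>M"
    proof (rule bounded_derivative_imp_lipschitz[OF _ K0(2)])
      show "0 \<le> L Cf" using order_trans[OF norm_ge_zero Dr_le[OF zero]] .
      fix z assume z: "z \<in> K0"
      have "((\<lambda>z. (Shat z - S dt z) /\<^sub>R dt + (S dt z - z - dt *\<^sub>R F z) /\<^sub>R dt)
          has_derivative blinfun_apply (Dr z)) (at z)"
        using z K0(3) Bstar_sub dt unfolding Dr_def
        by (auto intro!: derivative_eq_intros S_der(3) Sh_der(3) F_der(3)
            simp: blinfun.bilinear_simps)
      \<comment> \<open>The split form agrees with \<open>r\<^sub>M\<close> on the ball only, hence
        the transfer on the open set \<open>K0\<close>.\<close>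
      then have "(r\<^sub>M has_derivative blinfun_apply (Dr z)) (at z)"
        by (rule has_derivative_transform_within_open[OF _ K0(1) z]) (use r_split K0(3) in auto)
      then show "(r\<^sub>M has_derivative blinfun_apply (Dr z)) (at z within K0)"
        by (rule has_derivative_at_withinI)
      show "onorm (blinfun_apply (Dr z)) \<le> L Cf"
        using Dr_le z K0(3) by (auto simp: norm_blinfun.rep_eq[symmetric])
    qed
    show "continuous_on (closure K0) r\<^sub>M" unfolding closure_K0 by (rule r_cont)
  qed
  have ell_le: "ell \<le> \<eta> / dt + Cf * dt"
    if "flow_consistency_bound Bstar F DF (S dt) dt Cf" for Cf
    using lipschitz_const_on_le[OF lip[OF that] b(1) zero b(2)] by (simp add: ell_eq L_def)
  \<comment> \<open>Any consistency constant makes \<open>r\<^sub>M\<close> Lipschitz; the estimate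
    itself then holds with the sharp value \<open>ell\<close>.\<close>
  have r_lip: "norm (r\<^sub>M z' - r\<^sub>M z) \<le> ell * norm (z' - z)" if "z \<in> Bstar" "z' \<in> Bstar" for z z'
    using flow norm_diff_le_lipschitz_const_on[OF lip that] by (auto simp: ell_eq)

  \<comment> \<open>Decay of the tracking error\<close>
  have tracking: "(norm (v t - u t))\<^sup>2 \<le>
       exp (- \<gamma> * (t - Tstar)) * (norm (v Tstar - u Tstar))\<^sup>2 +
       \<delta>\<^sup>2 / (lam1 * \<nu>_eff * \<gamma>) * (1 - exp (- \<gamma> * (t - Tstar)))"
    if gamma: "\<gamma> = \<mu> - 2 * (C_sq + ell)" "\<gamma> > 0"
      and nueff: "\<nu>_eff = \<nu> - \<mu> * c0\<^sup>2 * h\<^sup>2 / 2" and small: "\<mu> * c0\<^sup>2 * h\<^sup>2 < \<nu>"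
      and u: "ode_solution (\<lambda>_. F) u"
      and v: "ode_solution (\<lambda>t x. F\<^sub>M x - \<mu> *\<^sub>R (I h x - I h (u t))) v"
      and Tstar: "Tstar \<ge> 0" and inB: "\<forall>t\<ge>Tstar. u t \<in> Bstar \<and> v t \<in> Bstar" and t: "t \<ge> Tstar"
    for \<gamma> \<nu>_eff u v Tstar t
  proof -
    define w where "w s = v s - u s" for s
    define w' where "w' s = F\<^sub>M (v s) - \<mu> *\<^sub>R (I h (v s) - I h (u s)) - F (u s)" for s
    have w_der: "(w has_vector_derivative w' s) (at s within {Tstar..t})" if s: "s \<in> {Tstar..t}" for s
    proof -
      have "(w has_vector_derivative w' s) (at s within {0..})"
        unfolding w_def w'_def
        using u v s Tstar by (intro has_vector_derivative_diff) (auto simp: ode_solution_def)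
      then show ?thesis by (rule has_vector_derivative_within_subset) (use Tstar in auto)
    qed
    have w_le: "2 * (w' s \<bullet> w s) \<le> - \<gamma> * (w s \<bullet> w s) + \<delta>\<^sup>2 / (lam1 * \<nu>_eff)" if s: "s \<in> {Tstar..t}" for s
    proof -
      have B: "u s \<in> Bstar" "v s \<in> Bstar" using inB s by auto
      have Ih: "linear (I h)" "\<And>z. norm (z - I h z) \<le> c0 * h * energy_norm A z"
        using interp(3) h by auto
      \<comment> \<open>Places the energy ball in the Euclidean ball whose radius is the one in the
        definition of \<open>C_sq\<close>.\<close>
      have norm_le: "norm z \<le> Rstar / sqrt lam1" if "z \<in> Bstar" for z
        using norm_le_energy_norm[OF A_spd, of z] that lam1
        by (auto simp: Bstar_eq lam1_eq elim!: order_trans intro!: divide_right_mono)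
      have "2 * ((r\<^sub>M (v s) - \<nu> *\<^sub>R (A *v w s) - (N (v s) - N (u s)) - \<mu> *\<^sub>R I h (w s)) \<bullet> w s)
          \<le> - (\<mu> - 2 * (C_sq + ell)) * (norm (w s))\<^sup>2
            + \<delta>\<^sup>2 / (smallest_eigenvalue A * (\<nu> - \<mu> * (c0 * h)\<^sup>2 / 2))"
      proof (rule nudging_dissipation[OF A_spd _ Ih(2) _ mu])
        have "Rstar / sqrt lam1 > 0" using Rstar lam1 by simp
        then show "- ((N (v s) - N (u s)) \<bullet> w s) \<le> C_sq * (norm (w s))\<^sup>2"
          using local_mono norm_le B unfolding C_sq_eq w_def by blast
        \<comment> \<open>The error at \<open>u s\<close> contributes \<open>\<delta>\<close>, its
          increment from \<open>u s\<close> to \<open>v s\<close> contributes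
          \<open>ell * norm (w s)\<close>.\<close>
        have "norm (r\<^sub>M (v s)) \<le> norm (r\<^sub>M (u s)) + norm (r\<^sub>M (v s) - r\<^sub>M (u s))"
          by (rule norm_triangle_sub)
        then show "norm (r\<^sub>M (v s)) \<le> \<delta> + ell * norm (w s)"
          using r_le[OF B(1)] r_lip[OF B] by (simp add: w_def)
        show "\<mu> * (c0 * h)\<^sup>2 < 2 * \<nu>" using small nu by (simp add: power_mult_distrib mult.assoc)
      qed
      \<comment> \<open>With \<open>F\<^sub>M = F + r\<^sub>M\<close>, the difference of
        \<open>F\<close> at \<open>v s\<close> and \<open>u s\<close> supplies the viscous and
        nonlinear terms while \<open>f\<close> cancels; linearity of \<open>I h\<close> merges the
        nudging terms.\<close>
      also have "r\<^sub>M (v s) - \<nu> *\<^sub>R (A *v w s) - (N (v s) - N (u s)) - \<mu> *\<^sub>R I h (w s) = w' s"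
        by (simp add: w'_def w_def r_eq F_eq linear_diff[OF Ih(1)] matrix_vector_mult_diff_distrib
            algebra_simps)
      finally show ?thesis
        by (simp add: gamma nueff lam1_eq power2_norm_eq_inner power_mult_distrib mult.assoc)
    qed
    have "w t \<bullet> w t \<le> exp (- \<gamma> * (t - Tstar)) * (w Tstar \<bullet> w Tstar)
        + (\<delta>\<^sup>2 / (lam1 * \<nu>_eff)) / \<gamma> * (1 - exp (- \<gamma> * (t - Tstar)))"
    proof (rule gronwall_affine[where y' = "\<lambda>s. 2 * (w' s \<bullet> w s)" and b = t])
      fix s assume s: "s \<in> {Tstar..t}"
      show "((\<lambda>s. w s \<bullet> w s) has_vector_derivative 2 * (w' s \<bullet> w s)) (at s within {Tstar..t})"
        using bounded_bilinear.has_vector_derivative[OF bounded_bilinear_inner w_der[OF s] w_der[OF s]]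
        by (simp add: inner_commute)
    qed (use w_le gamma t in auto)
    then show ?thesis by (simp add: w_def power2_norm_eq_inner)
  qed

  have rate: "\<mu> > 2 * (C_sq + ell)"
    if "flow_consistency_bound Bstar F DF (S dt) dt Cf" "\<mu> > 2 * (C_sq + \<eta> / dt + Cf * dt)" for Cf
    using mult_left_mono[OF add_left_mono[OF ell_le[OF that(1)], of C_sq], of 2] that(2)
    by (simp only: add.assoc) simp
  show ?thesis
    unfolding Let_def
  proof (intro conjI allI impI ballI, goal_cases)
    \<comment> \<open>The seventh goal is the error estimate; \<open>rate\<close> makes its decay
      rate positive.\<close>
    case (7 Cf u v Tstar t)
    then show ?case
      using rate[of Cf] by (intro tracking[OF refl _ refl]) auto
  qed (use S_C1 flow FM delta_le ell_le rate in auto)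
qed

end
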